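(* Let $d \in \mathbb{N}$, let $x \in C^{1}([0,\infty),\mathbb{R}^{d})$, let $F \in C^{1}(\mathbb{R}^{d},\mathbb{R})$, and let $\|\cdot\| \colon \mathbb{R}^{d} \to [0,\infty)$ be a norm. Assume that $\inf_{t\in[0,\infty)} F(x(t)) > -\infty$ and assume for all $t \in [0,\infty)$ that $$x'(t) = -(\nabla F)(x(t)).$$ Then: (i) $F(x(t))$ converges in $\mathbb{R}$ as $t \to \infty$; and (ii) $\int_{0}^{\infty} \|(\nabla F)(x(s))\|^{2}\, \mathrm{d}s < \infty$.
   Context: $\mathbb{N}=\{1,2,3,\dots\}$. $C^{1}(A,B)$ denotes the set of continuously differentiable functions from $A$ to $B$ (one-sided derivative at $t=0$ for functions on $[0,\infty)$). $\nabla F$ denotes the usual gradient of $F$ with respect to the standard Euclidean inner product on $\mathbb{R}^{d}$ (the vector of partial derivatives). *)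

theory Defs
  imports "HOL-Analysis.Analysis"
begin

(* The derivative is taken relative to A, hence it is one-sided at the end point of {0..};
   its continuity is meant in operator norm. *)
definition C1_on :: "('a::real_normed_vector \<Rightarrow> 'b::real_normed_vector) \<Rightarrow> 'a set \<Rightarrow> bool" where
  "C1_on f A \<longleftrightarrow>
     (\<exists>D :: 'a \<Rightarrow> ('a \<Rightarrow>\<^sub>L 'b).
        (\<forall>a\<in>A. (f has_derivative blinfun_apply (D a)) (at a within A)) \<and> continuous_on A D)"

definition grad :: "(real ^ 'd \<Rightarrow> real) \<Rightarrow> real ^ 'd \<Rightarrow> real ^ 'd" where
  "grad F a = (\<chi> i. deriv (\<lambda>h. F (a + h *\<^sub>R axis i 1)) 0)"

(* The type class real_normed_vector only provides the Euclidean norm on real ^ 'd,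
   so an arbitrary norm is a function satisfying the norm axioms. *)
definition is_norm :: "('a::real_vector \<Rightarrow> real) \<Rightarrow> bool" where
  "is_norm N \<longleftrightarrow>
     (\<forall>v. 0 \<le> N v) \<and>
     (\<forall>v. N v = 0 \<longleftrightarrow> v = 0) \<and>
     (\<forall>c v. N (c *\<^sub>R v) = \<bar>c\<bar> * N v) \<and>
     (\<forall>v w. N (v + w) \<le> N v + N w)"

lemma grad_eqI:
  assumes "GDERIV F a :> D"
  shows "grad F a = D"
proof -
  have "deriv (\<lambda>h. F (a + h *\<^sub>R axis i 1)) 0 = D $ i" for i
  proof (rule DERIV_imp_deriv)
    have F: "(F has_derivative (\<lambda>h. inner h D)) (at (a + 0 *\<^sub>R axis i 1))"
      using assms by (simp add: gderiv_def)
    have "((\<lambda>h::real. a + h *\<^sub>R axis i 1) has_derivative (\<lambda>h. h *\<^sub>R axis i 1)) (at 0)"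
      by (auto intro!: derivative_eq_intros)
    from has_derivative_compose[OF this F]
    show "((\<lambda>h. F (a + h *\<^sub>R axis i 1)) has_field_derivative D $ i) (at 0)"
      by (simp add: has_field_derivative_def inner_axis' mult_commute_abs)
  qed
  then show ?thesis
    by (simp add: grad_def vec_eq_iff)
qed

lemma C1_on_imp_GDERIV_grad:
  assumes "C1_on F UNIV"
  shows "GDERIV F a :> grad F a"
proof -
  from assms obtain D where D: "(F has_derivative blinfun_apply (D a)) (at a)"
    by (auto simp: C1_on_def)
  have "blinfun_apply (D a) h = inner h (adjoint (blinfun_apply (D a)) 1)" for h
    using adjoint_works[OF bounded_linear.linear[OF blinfun.bounded_linear_right[of "D a"]], of h 1] by (simp add: inner_commute)
  then have "blinfun_apply (D a) = (\<lambda>h. inner h (adjoint (blinfun_apply (D a)) 1))"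
    by blast
  with D have "GDERIV F a :> adjoint (blinfun_apply (D a)) 1"
    unfolding gderiv_def by metis
  with grad_eqI[OF this] show ?thesis
    by simp
qed

end

(* Along the flow, (F o x)' = - |grad F (x t)|^2 for the Euclidean norm. So F o x is decreasing and
   bounded below, hence converges, and the total decrease is the integral of |grad F (x t)|^2.
   All norms on R^d being bounded by a multiple of the Euclidean one, finiteness carries over. *)
theory Submission
  imports Defs
begin

text \<open>Expand \<open>v\<close> in the standard basis: the triangle inequality and homogeneity
  bound \<open>N v\<close> by the sum of |v . b| * \<open>N b\<close>, and each coordinate is at
  most \<open>norm v\<close>. So \<open>C\<close> is the sum of \<open>N\<close> over
  \<open>Basis\<close>.\<close>

lemma is_norm_le_norm:
  fixes N :: "'a::euclidean_space \<Rightarrow> real"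
  assumes "is_norm N"
  obtains C where "0 \<le> C" "\<And>v. N v \<le> C * norm v"
proof
  have N0: "0 \<le> N v" and N_zero: "N 0 = 0" and scale: "N (c *\<^sub>R v) = \<bar>c\<bar> * N v"
    and tri: "N (v + w) \<le> N v + N w" for v w c
    using assms by (auto simp: is_norm_def)
  show "0 \<le> (\<Sum>b\<in>Basis. N b)"
    by (simp add: sum_nonneg N0)
  fix v :: 'a
  have "N (\<Sum>b\<in>B. (v \<bullet> b) *\<^sub>R b) \<le> (\<Sum>b\<in>B. \<bar>v \<bullet> b\<bar> * N b)" if "finite B" for B
    using that
  proof induction
    case (insert b B)
    then show ?case
      using tri[of "(v \<bullet> b) *\<^sub>R b" "\<Sum>b\<in>B. (v \<bullet> b) *\<^sub>R b"] by (simp add: scale)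
  qed (simp add: N_zero)
  from this[OF finite_Basis] have "N v \<le> (\<Sum>b\<in>Basis. \<bar>v \<bullet> b\<bar> * N b)"
    by (simp add: euclidean_representation)
  also have "\<dots> \<le> (\<Sum>b\<in>Basis. norm v * N b)"
    by (intro sum_mono mult_right_mono Basis_le_norm N0)
  finally show "N v \<le> (\<Sum>b\<in>Basis. N b) * norm v"
    by (simp add: sum_distrib_left mult.commute)
qed

text \<open>Uniqueness of the derivative identifies \<open>D a\<close> with the inner product
  against \<open>grad F a\<close>. Each coordinate of the gradient is thus \<open>D a\<close> at a
  fixed axis vector, so it inherits the operator-norm continuity of \<open>D\<close>.\<close>

lemma C1_on_imp_continuous_on_grad:
  assumes "C1_on F UNIV"
  shows "continuous_on UNIV (grad F)"
proof -
  from assms obtain D where D: "\<And>a. (F has_derivative blinfun_apply (D a)) (at a)"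
    and cont: "continuous_on UNIV D"
    by (auto simp: C1_on_def)
  have "blinfun_apply (D a) = (\<lambda>h. inner h (grad F a))" for a
    using C1_on_imp_GDERIV_grad[OF assms, of a] D[of a]
    unfolding gderiv_def by (rule has_derivative_unique[symmetric])
  then have "grad F = (\<lambda>a. \<chi> i. blinfun_apply (D a) (axis i 1))"
    by (simp add: fun_eq_iff vec_eq_iff inner_axis')
  moreover have "continuous_on UNIV (\<lambda>a. \<chi> i. blinfun_apply (D a) (axis i 1))"
    by (intro continuous_intros cont)
  ultimately show ?thesis
    by simp
qed

text \<open>A monotone bounded function has a limit, and the fundamental theorem on the half-line
  turns the integral of its nonnegative derivative into the total increase. It will be applied to
  \<open>- F (x t)\<close>, differentiable only one-sidedly at 0.\<close>

lemma nondecreasing_bounded_FTC_atLeast: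
  fixes f f' :: "real \<Rightarrow> real"
  assumes deriv: "\<And>t. a \<le> t \<Longrightarrow> (f has_vector_derivative f' t) (at t within {a..})"
    and cont: "continuous_on {a..} f'"
    and nonneg: "\<And>t. a \<le> t \<Longrightarrow> 0 \<le> f' t"
    and bound: "\<And>t. a \<le> t \<Longrightarrow> f t \<le> B"
  obtains L where "(f \<longlongrightarrow> L) at_top"
    and "(\<integral>\<^sup>+ t\<in>{a..}. ennreal (f' t) \<partial>lborel) = ennreal (L - f a)"
proof -
  text \<open>The affine extension to the left of \<open>a\<close> turns the one-sided derivative at \<open>a\<close> into a
    two-sided one, as needed for \<open>nn_integral_FTC_atLeast\<close>.\<close>
  define g where "g t = (if t \<in> {a..} then f t else f a + (t - a) * f' a)" for t
  define g' where "g' t = f' (max a t)" for t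
  have der: "(g has_real_derivative g' t) (at t)" for t
  proof -
    have "(g has_vector_derivative (if t \<in> {a..} then f' t else f' a)) (at t within UNIV)"
      unfolding g_def
    \<comment> \<open>The closures of the two half-lines meet only at \<open>a\<close>, where both
      branches have value \<open>f a\<close> and derivative \<open>f' a\<close>.\<close>
    proof (rule has_vector_derivative_If_within_closures)
      show "(f has_vector_derivative f' t) (at t within {a..} \<union> closure {a..} \<inter> closure {..<a})"
        if "t \<in> {a..} \<union> closure {a..} \<inter> closure {..<a}"
        using that deriv[of t] by (simp add: Un_absorb2)
      show "((\<lambda>t. f a + (t - a) * f' a) has_vector_derivative f' a)
          (at t within {..<a} \<union> closure {a..} \<inter> closure {..<a})"
        by (auto intro!: derivative_eq_intros simp flip: has_real_derivative_iff_has_vector_derivative)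
    qed auto
    moreover have "(if t \<in> {a..} then f' t else f' a) = g' t"
      by (simp add: g'_def)
    ultimately show ?thesis
      by (simp add: has_real_derivative_iff_has_vector_derivative)
  qed
  have g'_nonneg: "0 \<le> g' t" for t
    by (simp add: g'_def nonneg)
  \<comment> \<open>Since \<open>g'\<close> is \<open>f'\<close> composed with the clamp
    \<open>max a\<close>, its continuity needs no gluing at \<open>a\<close>.\<close>
  have "continuous_on UNIV g'"
    unfolding g'_def by (rule continuous_on_compose2[OF cont]) (auto intro!: continuous_intros)
  then have meas: "g' \<in> borel_measurable borel"
    by (rule borel_measurable_continuous_onI)
  have mono: "mono g"
    by (rule monoI, rule DERIV_nonneg_imp_nondecreasing) (use der g'_nonneg in auto)
  \<comment> \<open>\<open>bound\<close> speaks only of times from \<open>a\<close> on; earlier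
    values of \<open>g\<close> lie below \<open>g a\<close> by monotonicity.\<close>
  have g_le: "g t \<le> B" for t
    using monoD[OF mono, of t "max a t"] bound[of "max a t"] by (simp add: g_def split: if_splits)
  have "incseq (\<lambda>n. g (real n))"
    using mono by (simp add: incseq_def monoD)
  then obtain L where "(\<lambda>n. g (real n)) \<longlonglongrightarrow> L"
    using incseq_convergent g_le by blast
  then have lim: "(g \<longlongrightarrow> L) at_top"
    by (intro tendsto_at_topI_sequentially_real[OF mono])
  show ?thesis
  proof
    show "(f \<longlongrightarrow> L) at_top"
      using lim by (rule Lim_transform_eventually)
        (auto simp: g_def intro: eventually_mono[OF eventually_ge_at_top[of a]])
    have "(\<integral>\<^sup>+ t\<in>{a..}. ennreal (f' t) \<partial>lborel) = (\<integral>\<^sup>+ t\<in>{a..}. ennreal (g' t) \<partial>lborel)"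
      by (intro nn_integral_cong) (auto simp: g'_def indicator_def)
    also have "\<dots> = ennreal (L - g a)"
      by (rule nn_integral_FTC_atLeast[OF meas der g'_nonneg lim])
    finally show "(\<integral>\<^sup>+ t\<in>{a..}. ennreal (f' t) \<partial>lborel) = ennreal (L - f a)"
      by (simp add: g_def)
  qed
qed

theorem theorem1:
  fixes x :: "real \<Rightarrow> real ^ 'd"
    and F :: "real ^ 'd \<Rightarrow> real"
    and N :: "real ^ 'd \<Rightarrow> real"
  assumes "C1_on x {0..}"
    and "C1_on F UNIV"
    and "is_norm N"
    and "(INF t\<in>{0..}. ereal (F (x t))) > - \<infinity>"
    and "\<forall>t\<ge>0. (x has_vector_derivative - grad F (x t)) (at t within {0..})"
  shows "(\<exists>L::real. ((\<lambda>t. F (x t)) \<longlongrightarrow> L) at_top) \<and>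
         (\<integral>\<^sup>+ s\<in>{0..}. ennreal ((N (grad F (x s)))\<^sup>2) \<partial>lborel) < \<infinity>"
proof -
  obtain B where B: "\<And>t. 0 \<le> t \<Longrightarrow> B \<le> F (x t)"
  proof -
    \<comment> \<open>The infimum is an extended real, so a real number strictly below it serves as
      \<open>B\<close>.\<close>
    obtain r :: real where r: "- \<infinity> < ereal r" "ereal r < (INF t\<in>{0..}. ereal (F (x t)))"
      using ereal_dense2[OF assms(4)] by auto
    have "r \<le> F (x t)" if "0 \<le> t" for t
    proof -
      have "(INF t\<in>{0..}. ereal (F (x t))) \<le> ereal (F (x t))"
        using that by (intro INF_lower) auto
      with r show ?thesis
        by (metis ereal_less_eq(3) less_imp_le order_trans)
    qed
    then show ?thesis
      by (rule that)
  qed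
  have cont: "continuous_on {0..} (\<lambda>t. grad F (x t))"
  proof (rule continuous_on_compose2[OF C1_on_imp_continuous_on_grad[OF assms(2)]])
    show "continuous_on {0..} x"
      using assms(5) by (intro continuous_on_vector_derivative) auto
  qed auto
  \<comment> \<open>The sign is flipped to obtain a nondecreasing function; the lower bound
    \<open>B\<close> becomes the upper bound \<open>- B\<close>.\<close>
  have deriv: "((\<lambda>t. - F (x t)) has_vector_derivative (norm (grad F (x t)))\<^sup>2) (at t within {0..})"
    if "0 \<le> t" for t
  proof -
    have "(x has_derivative (\<lambda>h. h *\<^sub>R - grad F (x t))) (at t within {0..})"
      using assms(5) that by (simp add: has_vector_derivative_def)
    moreover have "(F has_derivative (\<lambda>h. inner h (grad F (x t)))) (at (x t))"
      using C1_on_imp_GDERIV_grad[OF assms(2)] by (simp add: gderiv_def)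
    ultimately have "((\<lambda>t. F (x t)) has_derivative (\<lambda>h. inner (h *\<^sub>R - grad F (x t)) (grad F (x t))))
        (at t within {0..})"
      by (rule has_derivative_compose)
    from has_derivative_minus[OF this] show ?thesis
      by (simp add: has_vector_derivative_def power2_norm_eq_inner)
  qed
  obtain L where lim: "((\<lambda>t. - F (x t)) \<longlongrightarrow> L) at_top"
    and int: "(\<integral>\<^sup>+ t\<in>{0..}. ennreal ((norm (grad F (x t)))\<^sup>2) \<partial>lborel) = ennreal (L - - F (x 0))"
  proof (rule nondecreasing_bounded_FTC_atLeast[OF deriv])
    show "continuous_on {0..} (\<lambda>t. (norm (grad F (x t)))\<^sup>2)"
      by (intro continuous_intros cont)
    show "- F (x t) \<le> - B" if "0 \<le> t" for t
      using B[OF that] by simp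
  qed auto
  obtain C where C: "0 \<le> C" "\<And>v. N v \<le> C * norm v"
    using is_norm_le_norm[OF assms(3)] by blast
  have N_le: "(N v)\<^sup>2 \<le> C\<^sup>2 * (norm v)\<^sup>2" for v
    using C(2)[of v] assms(3) power_mono[of "N v" "C * norm v" 2]
    by (simp add: is_norm_def power_mult_distrib)
  \<comment> \<open>Measurability allows the factor \<open>C\<^sup>2\<close> to be pulled out of the
    integral below. Continuity is known only on \<open>{0..}\<close>, hence the indicator.\<close>
  have "(\<lambda>t. indicat_real {0..} t *\<^sub>R (norm (grad F (x t)))\<^sup>2) \<in> borel_measurable borel"
    by (intro borel_measurable_continuous_on_indicator continuous_intros cont) auto
  then have "(\<lambda>t. ennreal (indicat_real {0..} t *\<^sub>R (norm (grad F (x t)))\<^sup>2)) \<in> borel_measurable lborel"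
    by simp
  also have "(\<lambda>t. ennreal (indicat_real {0..} t *\<^sub>R (norm (grad F (x t)))\<^sup>2))
      = (\<lambda>t. ennreal ((norm (grad F (x t)))\<^sup>2) * indicator {0..} t)"
    by (auto simp: indicator_def)
  finally have meas: "(\<lambda>t. ennreal ((norm (grad F (x t)))\<^sup>2) * indicator {0..} t)
      \<in> borel_measurable lborel" .
  have "(\<integral>\<^sup>+ s\<in>{0..}. ennreal ((N (grad F (x s)))\<^sup>2) \<partial>lborel)
      \<le> (\<integral>\<^sup>+ s. ennreal (C\<^sup>2) * (ennreal ((norm (grad F (x s)))\<^sup>2) * indicator {0..} s) \<partial>lborel)"
    by (intro nn_integral_mono) (auto simp: indicator_def N_le simp flip: ennreal_mult intro!: ennreal_leI)
  also have "\<dots> = ennreal (C\<^sup>2) * ennreal (L - - F (x 0))"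
    by (simp only: nn_integral_cmult[OF meas] int)
  also have "\<dots> < \<infinity>"
    by (simp add: ennreal_mult_less_top)
  finally have "(\<integral>\<^sup>+ s\<in>{0..}. ennreal ((N (grad F (x s)))\<^sup>2) \<partial>lborel) < \<infinity>" .
  moreover have "((\<lambda>t. F (x t)) \<longlongrightarrow> - L) at_top"
    using tendsto_minus[OF lim] by simp
  ultimately show ?thesis
    by blast
qed

end
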